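(* Let $R$ be a ring and let $V$ be an $(R,R)$-bimodule that is also a ring, with $(vw)r=v(wr)$, $(vr)w=v(rw)$ and $(rv)w=r(vw)$ for all $v,w\in V$ and $r\in R$. Let $D(R,V)$ be the Dorroh extension of $R$ by $V$. Then: (1) If $D(R,V)$ is $\delta$-quasipolar, then $R$ is $\delta$-quasipolar. (2) If the following conditions are satisfied, then $D(R,V)$ is $\delta$-quasipolar: (i) $R$ is $\delta$-quasipolar; (ii) if $e^2=e\in R$, then $ev=ve$ for all $v\in V$; (iii) $V=\delta(V)$.
   Context: All rings are associative with identity unless otherwise stated. The Dorroh extension $D(R,V)$ is the ring whose additive group is $R\oplus V$ and whose multiplication is $(r,v)(s,w)=(rs,\,rw+vs+vw)$ for $r,s\in R$, $v,w\in V$. For a ring $R$ and $a\in R$, $comm(a)=\{x\in R \mid xa=ax\}$ and $comm^2(a)=\{x\in R\mid xy=yx \text{ for all } y\in comm(a)\}$. A right ideal $I$ of $R$ is $\delta$-small if whenever $R=I+K$ with $K$ a right ideal such that $R/K$ is a singular right $R$-module, then $R=K$. $\delta(R)$ is the sum of all $\delta$-small right ideals of $R$; it is a two-sided ideal and equals the intersection of all essential maximal right ideals of $R$ (equal to $R$ if there are none). An element $a\in R$ is $\delta$-quasipolar if there exists $p^2=p\in comm^2(a)$ with $a+p\in\delta(R)$; $R$ is $\delta$-quasipolar if every element of $R$ is. *)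

theory Defs
  imports "HOL-Algebra.QuotRing" "HOL-Algebra.Module"
begin

section \<open>Right ideals and right modules\<close>

text \<open>
  The left and right modules of this theory are over arbitrary rings with identity, whereas
  \<^locale>\<open>module\<close> assumes a commutative ring. A module is a record \<open>M\<close>, of which only the additive
  part is used, together with a separate action; for a bimodule that is itself a ring, the same
  record then carries the multiplication.
\<close>

locale right_ideal = additive_subgroup I R + ring R for I and R (structure) +
  assumes r_closed: "\<lbrakk>a \<in> I; x \<in> carrier R\<rbrakk> \<Longrightarrow> a \<otimes> x \<in> I"

locale left_module = R: ring R + M: abelian_group M
  for R (structure) and M (structure) and lact :: "'a \<Rightarrow> 'b \<Rightarrow> 'b" +
  constrains R :: "('a, 'm) ring_scheme" and M :: "('b, 'n) ring_scheme"
  assumes lact_closed: "\<lbrakk>r \<in> carrier R; x \<in> carrier M\<rbrakk> \<Longrightarrow> lact r x \<in> carrier M"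
    and lact_l_distr: "\<lbrakk>r \<in> carrier R; s \<in> carrier R; x \<in> carrier M\<rbrakk>
      \<Longrightarrow> lact (r \<oplus>\<^bsub>R\<^esub> s) x = lact r x \<oplus>\<^bsub>M\<^esub> lact s x"
    and lact_r_distr: "\<lbrakk>r \<in> carrier R; x \<in> carrier M; y \<in> carrier M\<rbrakk>
      \<Longrightarrow> lact r (x \<oplus>\<^bsub>M\<^esub> y) = lact r x \<oplus>\<^bsub>M\<^esub> lact r y"
    and lact_assoc: "\<lbrakk>r \<in> carrier R; s \<in> carrier R; x \<in> carrier M\<rbrakk>
      \<Longrightarrow> lact (r \<otimes>\<^bsub>R\<^esub> s) x = lact r (lact s x)"
    and lact_one: "x \<in> carrier M \<Longrightarrow> lact \<one>\<^bsub>R\<^esub> x = x"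

locale right_module = R: ring R + M: abelian_group M
  for R (structure) and M (structure) and ract :: "'b \<Rightarrow> 'a \<Rightarrow> 'b" +
  constrains R :: "('a, 'm) ring_scheme" and M :: "('b, 'n) ring_scheme"
  assumes ract_closed: "\<lbrakk>x \<in> carrier M; r \<in> carrier R\<rbrakk> \<Longrightarrow> ract x r \<in> carrier M"
    and ract_l_distr: "\<lbrakk>x \<in> carrier M; y \<in> carrier M; r \<in> carrier R\<rbrakk>
      \<Longrightarrow> ract (x \<oplus>\<^bsub>M\<^esub> y) r = ract x r \<oplus>\<^bsub>M\<^esub> ract y r"
    and ract_r_distr: "\<lbrakk>x \<in> carrier M; r \<in> carrier R; s \<in> carrier R\<rbrakk>
      \<Longrightarrow> ract x (r \<oplus>\<^bsub>R\<^esub> s) = ract x r \<oplus>\<^bsub>M\<^esub> ract x s"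
    and ract_assoc: "\<lbrakk>x \<in> carrier M; r \<in> carrier R; s \<in> carrier R\<rbrakk>
      \<Longrightarrow> ract x (r \<otimes>\<^bsub>R\<^esub> s) = ract (ract x r) s"
    and ract_one: "x \<in> carrier M \<Longrightarrow> ract x \<one>\<^bsub>R\<^esub> = x"

locale bimodule = left_module R M lact + right_module R M ract
  for R (structure) and M (structure) and lact :: "'a \<Rightarrow> 'b \<Rightarrow> 'b" and ract :: "'b \<Rightarrow> 'a \<Rightarrow> 'b" +
  constrains R :: "('a, 'm) ring_scheme" and M :: "('b, 'n) ring_scheme"
  assumes lact_ract: "\<lbrakk>r \<in> carrier R; x \<in> carrier M; s \<in> carrier R\<rbrakk>
      \<Longrightarrow> ract (lact r x) s = lact r (ract x s)"

definition essential_right_ideal :: "('a, 'm) ring_scheme \<Rightarrow> 'a set \<Rightarrow> bool" where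
  "essential_right_ideal R I \<longleftrightarrow>
     right_ideal I R \<and> (\<forall>J. right_ideal J R \<and> J \<noteq> {\<zero>\<^bsub>R\<^esub>} \<longrightarrow> I \<inter> J \<noteq> {\<zero>\<^bsub>R\<^esub>})"

definition right_annihilator ::
    "('a, 'm) ring_scheme \<Rightarrow> ('b, 'n) ring_scheme \<Rightarrow> ('b \<Rightarrow> 'a \<Rightarrow> 'b) \<Rightarrow> 'b \<Rightarrow> 'a set" where
  "right_annihilator R M ract x = {r \<in> carrier R. ract x r = \<zero>\<^bsub>M\<^esub>}"

definition singular_right_module ::
    "('a, 'm) ring_scheme \<Rightarrow> ('b, 'n) ring_scheme \<Rightarrow> ('b \<Rightarrow> 'a \<Rightarrow> 'b) \<Rightarrow> bool" where
  "singular_right_module R M ract \<longleftrightarrow>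
     right_module R M ract \<and>
     (\<forall>x\<in>carrier M. essential_right_ideal R (right_annihilator R M ract x))"

text \<open>
  For a right ideal \<open>K\<close>, the right module \<open>R/K\<close> is the record \<open>R Quot K\<close> with the action below. Its
  additive part is the quotient group; its multiplication is meaningless unless \<open>K\<close> is two-sided
  and is not used.
\<close>

definition quot_ract :: "('a, 'm) ring_scheme \<Rightarrow> 'a set \<Rightarrow> 'a set \<Rightarrow> 'a \<Rightarrow> 'a set" where
  "quot_ract R K X r = (\<Union>x\<in>X. K +>\<^bsub>R\<^esub> (x \<otimes>\<^bsub>R\<^esub> r))"

section \<open>The ideal $\delta(R)$ and $\delta$-quasipolar rings\<close>

definition delta_small :: "('a, 'm) ring_scheme \<Rightarrow> 'a set \<Rightarrow> bool" where
  "delta_small R I \<longleftrightarrow>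
     right_ideal I R \<and>
     (\<forall>K. right_ideal K R \<and> carrier R = I <+>\<^bsub>R\<^esub> K
          \<and> singular_right_module R (R Quot K) (quot_ract R K) \<longrightarrow> carrier R = K)"

definition sum_right_ideals :: "('a, 'm) ring_scheme \<Rightarrow> 'a set set \<Rightarrow> 'a set" where
  "sum_right_ideals R \<I> =
     {finsum R f F | f F. finite F \<and> F \<subseteq> \<I> \<and> (\<forall>I\<in>F. f I \<in> I)}"

definition delta :: "('a, 'm) ring_scheme \<Rightarrow> 'a set" where
  "delta R = sum_right_ideals R {I. delta_small R I}"

definition comm :: "('a, 'm) ring_scheme \<Rightarrow> 'a \<Rightarrow> 'a set" where
  "comm R a = {x \<in> carrier R. x \<otimes>\<^bsub>R\<^esub> a = a \<otimes>\<^bsub>R\<^esub> x}"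

definition comm2 :: "('a, 'm) ring_scheme \<Rightarrow> 'a \<Rightarrow> 'a set" where
  "comm2 R a = {x \<in> carrier R. \<forall>y\<in>comm R a. x \<otimes>\<^bsub>R\<^esub> y = y \<otimes>\<^bsub>R\<^esub> x}"

definition delta_quasipolar_elem :: "('a, 'm) ring_scheme \<Rightarrow> 'a \<Rightarrow> bool" where
  "delta_quasipolar_elem R a \<longleftrightarrow>
     (\<exists>p\<in>comm2 R a. p \<otimes>\<^bsub>R\<^esub> p = p \<and> a \<oplus>\<^bsub>R\<^esub> p \<in> delta R)"

definition delta_quasipolar :: "('a, 'm) ring_scheme \<Rightarrow> bool" where
  "delta_quasipolar R \<longleftrightarrow> ring R \<and> (\<forall>a\<in>carrier R. delta_quasipolar_elem R a)"

section \<open>Dorroh extensions\<close>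

text \<open>
  The ring \<open>V\<close> is associative with identity, like every ring here, and the bimodule structure and
  the ring structure of \<open>V\<close> share the additive group of the record \<open>V\<close>.
\<close>

locale dorroh_pair = bimodule R V lact ract + V: ring V
  for R (structure) and V (structure) and lact :: "'a \<Rightarrow> 'b \<Rightarrow> 'b" and ract :: "'b \<Rightarrow> 'a \<Rightarrow> 'b" +
  constrains R :: "('a, 'm) ring_scheme" and V :: "('b, 'n) ring_scheme"
  assumes mult_ract: "\<lbrakk>v \<in> carrier V; w \<in> carrier V; r \<in> carrier R\<rbrakk>
      \<Longrightarrow> ract (v \<otimes>\<^bsub>V\<^esub> w) r = v \<otimes>\<^bsub>V\<^esub> ract w r"
    and ract_mult: "\<lbrakk>v \<in> carrier V; w \<in> carrier V; r \<in> carrier R\<rbrakk>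
      \<Longrightarrow> ract v r \<otimes>\<^bsub>V\<^esub> w = v \<otimes>\<^bsub>V\<^esub> lact r w"
    and lact_mult: "\<lbrakk>v \<in> carrier V; w \<in> carrier V; r \<in> carrier R\<rbrakk>
      \<Longrightarrow> lact r v \<otimes>\<^bsub>V\<^esub> w = lact r (v \<otimes>\<^bsub>V\<^esub> w)"

definition dorroh ::
    "('a, 'm) ring_scheme \<Rightarrow> ('b, 'n) ring_scheme \<Rightarrow> ('a \<Rightarrow> 'b \<Rightarrow> 'b) \<Rightarrow> ('b \<Rightarrow> 'a \<Rightarrow> 'b)
      \<Rightarrow> ('a \<times> 'b) ring" where
  "dorroh R V lact ract =
     \<lparr>carrier = carrier R \<times> carrier V,
      mult = (\<lambda>(r, v) (s, w).
        (r \<otimes>\<^bsub>R\<^esub> s, lact r w \<oplus>\<^bsub>V\<^esub> ract v s \<oplus>\<^bsub>V\<^esub> v \<otimes>\<^bsub>V\<^esub> w)),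
      one = (\<one>\<^bsub>R\<^esub>, \<zero>\<^bsub>V\<^esub>),
      zero = (\<zero>\<^bsub>R\<^esub>, \<zero>\<^bsub>V\<^esub>),
      add = (\<lambda>(r, v) (s, w). (r \<oplus>\<^bsub>R\<^esub> s, v \<oplus>\<^bsub>V\<^esub> w))\<rparr>"

section \<open>Well-definedness of the constructions\<close>

lemma (in right_ideal) abelian_subgroup_right_ideal: "abelian_subgroup I R"
  by (intro abelian_subgroupI3 additive_subgroup_axioms abelian_group_axioms)

lemma (in right_ideal) quot_ract_coset:
  assumes x: "x \<in> carrier R" and r: "r \<in> carrier R"
  shows "quot_ract R I (I +> x) r = I +> (x \<otimes> r)"
proof -
  interpret A: abelian_subgroup I R by (rule abelian_subgroup_right_ideal)
  have eq: "I +> (y \<otimes> r) = I +> (x \<otimes> r)" if y: "y \<in> I +> x" for y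
  proof -
    obtain h where h: "h \<in> I" and yh: "y = h \<oplus> x"
      using y unfolding a_r_coset_def' by (elim UN_E singletonE)
    have "y \<otimes> r = h \<otimes> r \<oplus> x \<otimes> r"
      unfolding yh by (rule l_distr[OF a_Hcarr[OF h] x r])
    then have "y \<otimes> r \<in> I +> (x \<otimes> r)"
      unfolding a_r_coset_def' by (simp only:) (rule UN_I[OF r_closed[OF h r] singletonI])
    then show ?thesis
      by (rule A.a_repr_independence'[symmetric]) (rule m_closed[OF x r])
  qed
  show ?thesis
    unfolding quot_ract_def by (rule UN_constant_eq[OF A.a_rcos_self[OF x]]) (intro ballI eq)
qed

lemma (in right_ideal) quot_right_module: "right_module R (R Quot I) (quot_ract R I)"
proof -
  interpret A: abelian_subgroup I R by (rule abelian_subgroup_right_ideal)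
  have grp: "abelian_group (R Quot I)"
    by (intro comm_group_abelian_groupI)
      (simp add: FactRing_def A.a_factorgroup_is_comm_group[unfolded A_FactGroup_def'])
  have c: "\<exists>x\<in>carrier R. X = I +> x" if "X \<in> carrier (R Quot I)" for X
    using that by (auto simp: FactRing_simps)
  have c': "I +> x \<in> carrier (R Quot I)" if "x \<in> carrier R" for x
    using that by (auto simp: FactRing_simps)
  have a: "add (R Quot I) = set_add R" by (simp add: FactRing_def)
  show ?thesis
  proof (intro right_module.intro grp ring_axioms right_module_axioms.intro)
    fix X r assume X: "X \<in> carrier (R Quot I)" and r: "r \<in> carrier R"
    obtain x where "x \<in> carrier R" "X = I +> x" using c[OF X] by blast
    then show "quot_ract R I X r \<in> carrier (R Quot I)"
      using r by (simp add: quot_ract_coset c')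
  next
    fix X Y r assume X: "X \<in> carrier (R Quot I)" and Y: "Y \<in> carrier (R Quot I)"
      and r: "r \<in> carrier R"
    obtain x where "x \<in> carrier R" "X = I +> x" using c[OF X] by blast
    moreover obtain y where "y \<in> carrier R" "Y = I +> y" using c[OF Y] by blast
    ultimately show "quot_ract R I (X \<oplus>\<^bsub>R Quot I\<^esub> Y) r
        = quot_ract R I X r \<oplus>\<^bsub>R Quot I\<^esub> quot_ract R I Y r"
      using r by (simp add: a quot_ract_coset A.a_rcos_sum l_distr)
  next
    fix X r s assume X: "X \<in> carrier (R Quot I)" and rs: "r \<in> carrier R" "s \<in> carrier R"
    obtain x where "x \<in> carrier R" "X = I +> x" using c[OF X] by blast
    then show "quot_ract R I X (r \<oplus> s)
        = quot_ract R I X r \<oplus>\<^bsub>R Quot I\<^esub> quot_ract R I X s"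
      using rs by (simp add: a quot_ract_coset A.a_rcos_sum r_distr)
  next
    fix X r s assume X: "X \<in> carrier (R Quot I)" and rs: "r \<in> carrier R" "s \<in> carrier R"
    obtain x where "x \<in> carrier R" "X = I +> x" using c[OF X] by blast
    then show "quot_ract R I X (r \<otimes> s) = quot_ract R I (quot_ract R I X r) s"
      using rs by (simp add: quot_ract_coset m_assoc)
  next
    fix X assume X: "X \<in> carrier (R Quot I)"
    obtain x where "x \<in> carrier R" "X = I +> x" using c[OF X] by blast
    then show "quot_ract R I X \<one> = X"
      by (simp add: quot_ract_coset)
  qed
qed

lemma (in dorroh_pair) dorroh_ring: "ring (dorroh R V lact ract)"
proof -
  have z1: "lact r \<zero>\<^bsub>V\<^esub> = \<zero>\<^bsub>V\<^esub>" if "r \<in> carrier R" for r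
    using lact_r_distr[OF that M.zero_closed M.zero_closed] lact_closed[OF that M.zero_closed]
    by (simp add: M.add.r_cancel_one)
  have z2: "ract \<zero>\<^bsub>V\<^esub> r = \<zero>\<^bsub>V\<^esub>" if "r \<in> carrier R" for r
    using ract_l_distr[OF M.zero_closed M.zero_closed that] ract_closed[OF M.zero_closed that]
    by (simp add: M.add.r_cancel_one)
  show ?thesis
  proof (rule ringI)
    show "abelian_group (dorroh R V lact ract)"
    proof (rule abelian_groupI)
      fix x assume "x \<in> carrier (dorroh R V lact ract)"
      then obtain r v where x: "x = (r, v)" "r \<in> carrier R" "v \<in> carrier V"
        by (auto simp: dorroh_def)
      show "\<exists>y\<in>carrier (dorroh R V lact ract).
          y \<oplus>\<^bsub>dorroh R V lact ract\<^esub> x = \<zero>\<^bsub>dorroh R V lact ract\<^esub>"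
        using x by (intro bexI[of _ "(\<ominus>\<^bsub>R\<^esub> r, \<ominus>\<^bsub>V\<^esub> v)"]) (auto simp: dorroh_def R.l_neg M.l_neg)
    qed (auto simp: dorroh_def R.a_ac M.a_ac)
    show "Group.monoid (dorroh R V lact ract)"
      by (rule Group.monoidI)
        (auto simp: dorroh_def R.m_assoc V.m_assoc lact_closed ract_closed lact_assoc ract_assoc
          lact_one ract_one z1 z2 lact_r_distr ract_l_distr V.l_distr V.r_distr lact_ract
          mult_ract ract_mult lact_mult M.a_ac)
  qed (auto simp: dorroh_def R.l_distr R.r_distr V.l_distr V.r_distr lact_l_distr lact_r_distr
        ract_l_distr ract_r_distr lact_closed ract_closed M.a_ac)
qed

end

theory Submission
  imports Defs
begin

text \<open>
  Since \<open>V\<close> has an identity, \<open>f r = r 1 = 1 r\<close> is a ring homomorphism from \<open>R\<close> to \<open>V\<close>, the actions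
  are \<open>r v = f r * v\<close> and \<open>v r = v * f r\<close>, and \<open>(r, v) \<mapsto> (r, f r + v)\<close> identifies the
  Dorroh extension with the direct product of \<open>R\<close> and \<open>V\<close>. The ideal $\delta$ is mapped into $\delta$
  by surjective homomorphisms and by the inclusion of a direct factor, so
  $\delta(R \times V) = \delta(R) \times \delta(V)$. If $\delta(V) = V$ and \<open>p\<close> witnesses that \<open>r\<close> is
  $\delta$-quasipolar, then \<open>(p, 0)\<close> witnesses it for \<open>(r, w)\<close> in the product.
\<close>

section \<open>Right ideals\<close>

lemma (in ring) right_idealI:
  assumes "I \<subseteq> carrier R" "\<zero> \<in> I"
    and "\<And>a b. \<lbrakk>a \<in> I; b \<in> I\<rbrakk> \<Longrightarrow> a \<oplus> b \<in> I"
    and mult: "\<And>a x. \<lbrakk>a \<in> I; x \<in> carrier R\<rbrakk> \<Longrightarrow> a \<otimes> x \<in> I"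
  shows "right_ideal I R"
proof (intro right_ideal.intro right_ideal_axioms.intro additive_subgroup.intro ring_axioms mult)
  \<comment> \<open>Negatives come from right multiplication: - a = a (- 1).\<close>
  have "\<ominus> a \<in> I" if "a \<in> I" for a
    using mult[OF that, of "\<ominus> \<one>"] assms(1) that by (auto simp: r_minus)
  then show "subgroup I (add_monoid R)"
    using assms by (intro add.subgroupI) (auto simp: a_inv_def)
qed

lemma right_ideal_simps:
  assumes "right_ideal I R"
  shows "I \<subseteq> carrier R" "\<zero>\<^bsub>R\<^esub> \<in> I"
    and "\<And>a b. \<lbrakk>a \<in> I; b \<in> I\<rbrakk> \<Longrightarrow> a \<oplus>\<^bsub>R\<^esub> b \<in> I"
    and "\<And>a x. \<lbrakk>a \<in> I; x \<in> carrier R\<rbrakk> \<Longrightarrow> a \<otimes>\<^bsub>R\<^esub> x \<in> I"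
proof -
  interpret right_ideal I R by fact
  show "I \<subseteq> carrier R" "\<zero>\<^bsub>R\<^esub> \<in> I"
    and "\<And>a b. \<lbrakk>a \<in> I; b \<in> I\<rbrakk> \<Longrightarrow> a \<oplus>\<^bsub>R\<^esub> b \<in> I"
    and "\<And>a x. \<lbrakk>a \<in> I; x \<in> carrier R\<rbrakk> \<Longrightarrow> a \<otimes>\<^bsub>R\<^esub> x \<in> I"
    using a_subset zero_closed a_closed r_closed by auto
qed

text \<open>The set is the annihilator of the coset of x in R/K. Knowing it to be a right ideal
  makes \<open>essential_right_ideal_iff\<close> applicable to it.\<close>

lemma right_ideal_transporter:
  assumes "right_ideal K R" "x \<in> carrier R"
  shows "right_ideal {r \<in> carrier R. x \<otimes>\<^bsub>R\<^esub> r \<in> K} R"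
proof -
  interpret right_ideal K R by fact
  show ?thesis
    using assms(2) right_ideal_simps[OF assms(1)]
    by (intro right_idealI) (auto simp: r_distr m_assoc[symmetric])
qed

text \<open>An element r kills the coset K + x exactly if K + x r is the zero coset K, that is, if x
  r lies in K. Singularity of R/K thus becomes a condition on subsets of R, and later arguments
  avoid cosets.\<close>

lemma singular_quotient_iff:
  fixes R (structure)
  assumes K: "right_ideal K R"
  shows "singular_right_module R (R Quot K) (quot_ract R K) \<longleftrightarrow>
    (\<forall>x\<in>carrier R. essential_right_ideal R {r \<in> carrier R. x \<otimes> r \<in> K})"
proof -
  interpret right_ideal K R by fact
  interpret A: abelian_subgroup K R by (rule abelian_subgroup_right_ideal)
  have "right_annihilator R (R Quot K) (quot_ract R K) (K +> x) =
      {r \<in> carrier R. x \<otimes> r \<in> K}" if "x \<in> carrier R" for x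
    using that A.a_rcos_self[of "x \<otimes> r" for r]
    by (auto simp: right_annihilator_def quot_ract_coset FactRing_def A.a_rcos_const)
  moreover have "carrier (R Quot K) = (\<lambda>x. K +> x) ` carrier R"
    by (auto simp: FactRing_simps)
  ultimately show ?thesis
    using quot_right_module by (auto simp: singular_right_module_def)
qed

text \<open>Right ideals contain zero, so differing from {0} amounts to having a nonzero element,
  and elements are easily moved along maps.\<close>

lemma essential_right_ideal_iff:
  assumes "right_ideal E R"
  shows "essential_right_ideal R E \<longleftrightarrow>
    (\<forall>J. right_ideal J R \<and> (\<exists>x\<in>J. x \<noteq> \<zero>\<^bsub>R\<^esub>) \<longrightarrow> (\<exists>x\<in>E \<inter> J. x \<noteq> \<zero>\<^bsub>R\<^esub>))"
proof -
  have "J \<noteq> {\<zero>\<^bsub>R\<^esub>} \<longleftrightarrow> (\<exists>x\<in>J. x \<noteq> \<zero>\<^bsub>R\<^esub>)" "E \<inter> J \<noteq> {\<zero>\<^bsub>R\<^esub>} \<longleftrightarrow> (\<exists>x\<in>E \<inter> J. x \<noteq> \<zero>\<^bsub>R\<^esub>)"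
    if "right_ideal J R" for J
    using right_ideal_simps(2)[OF that] right_ideal_simps(2)[OF assms] by auto
  then show ?thesis
    using assms unfolding essential_right_ideal_def by meson
qed

section \<open>Sums of right ideals\<close>

context ring
begin

text \<open>Asking S only to be an additive submonoid lets the preimage of \<delta> under an
  additive map serve as S, with no appeal to \<delta> being a right ideal.\<close>

lemma sum_right_ideals_subset:
  assumes S: "\<zero> \<in> S" "\<And>a b. \<lbrakk>a \<in> S; b \<in> S\<rbrakk> \<Longrightarrow> a \<oplus> b \<in> S"
    and sub: "\<And>I. I \<in> \<I> \<Longrightarrow> right_ideal I R" "\<And>I. I \<in> \<I> \<Longrightarrow> I \<subseteq> S"
  shows "sum_right_ideals R \<I> \<subseteq> S"
proof -
  have "finsum R f F \<in> S" if "finite F" "F \<subseteq> \<I>" "\<forall>I\<in>F. f I \<in> I" for f F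
    using that
  proof (induction F rule: finite_induct)
    case empty
    then show ?case using S by simp
  next
    case (insert I F)
    have "f \<in> F \<rightarrow> carrier R" "f I \<in> carrier R"
      using insert.prems right_ideal_simps(1)[OF sub(1)] by blast+
    moreover have "f I \<in> S" using insert.prems sub(2) by blast
    ultimately show ?case using insert S by simp
  qed
  then show ?thesis unfolding sum_right_ideals_def by blast
qed

lemma sum_right_ideals_superset:
  assumes "I \<in> \<I>" "right_ideal I R"
  shows "I \<subseteq> sum_right_ideals R \<I>"
proof
  fix x assume x: "x \<in> I"
  then have "x = finsum R (\<lambda>_. x) {I}"
    using right_ideal_simps(1)[OF assms(2)] by auto
  then show "x \<in> sum_right_ideals R \<I>"
    using x assms(1) unfolding sum_right_ideals_def
    by (intro CollectI exI[of _ "\<lambda>_. x"] exI[of _ "{I}"]) auto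
qed

lemma sum_right_ideals_zero: "\<zero> \<in> sum_right_ideals R \<I>"
  unfolding sum_right_ideals_def
  by (intro CollectI exI[of _ "\<lambda>_. \<zero>"] exI[of _ "{}"]) auto

lemma sum_right_ideals_add:
  assumes ri: "\<And>I. I \<in> \<I> \<Longrightarrow> right_ideal I R"
    and "x \<in> sum_right_ideals R \<I>" "y \<in> sum_right_ideals R \<I>"
  shows "x \<oplus> y \<in> sum_right_ideals R \<I>"
proof -
  obtain f F where F: "finite F" "F \<subseteq> \<I>" "\<forall>I\<in>F. f I \<in> I" "x = finsum R f F"
    using assms(2) unfolding sum_right_ideals_def by blast
  obtain g G where G: "finite G" "G \<subseteq> \<I>" "\<forall>I\<in>G. g I \<in> I" "y = finsum R g G"
    using assms(3) unfolding sum_right_ideals_def by blast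
  \<comment> \<open>Extending both families by zero to the union of F and G gives the two sums a
    common index set. Each I contains zero, so the summand at I stays in I.\<close>
  define f' where "f' I = (if I \<in> F then f I else \<zero>)" for I
  define g' where "g' I = (if I \<in> G then g I else \<zero>)" for I
  have fg: "f' I \<in> I" "g' I \<in> I" if "I \<in> F \<union> G" for I
    using that F G right_ideal_simps(2)[OF ri] by (auto simp: f'_def g'_def)
  have car: "f' \<in> F \<union> G \<rightarrow> carrier R" "g' \<in> F \<union> G \<rightarrow> carrier R"
    using fg F(2) G(2) right_ideal_simps(1)[OF ri] by blast+
  have "x = finsum R f' (F \<union> G)" unfolding F(4)
    using car F G by (intro add.finprod_mono_neutral_cong_left) (auto simp: f'_def)
  moreover have "y = finsum R g' (F \<union> G)" unfolding G(4)
    using car F G by (intro add.finprod_mono_neutral_cong_left) (auto simp: g'_def)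
  ultimately have "x \<oplus> y = finsum R (\<lambda>I. f' I \<oplus> g' I) (F \<union> G)"
    using car by (simp add: finsum_addf)
  moreover have "\<forall>I\<in>F \<union> G. f' I \<oplus> g' I \<in> I"
    using fg F(2) G(2) right_ideal_simps(3)[OF ri] by blast
  ultimately show ?thesis
    using F G unfolding sum_right_ideals_def
    by (intro CollectI exI[of _ "\<lambda>I. f' I \<oplus> g' I"] exI[of _ "F \<union> G"]) auto
qed

lemma delta_zero: "\<zero> \<in> delta R"
  unfolding delta_def by (rule sum_right_ideals_zero)

lemma delta_add: "\<lbrakk>x \<in> delta R; y \<in> delta R\<rbrakk> \<Longrightarrow> x \<oplus> y \<in> delta R"
  unfolding delta_def by (intro sum_right_ideals_add) (auto simp: delta_small_def)

lemma delta_superset: "delta_small R I \<Longrightarrow> I \<subseteq> delta R"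
  unfolding delta_def by (intro sum_right_ideals_superset) (auto simp: delta_small_def)

lemma delta_subset:
  assumes "\<zero> \<in> S" "\<And>a b. \<lbrakk>a \<in> S; b \<in> S\<rbrakk> \<Longrightarrow> a \<oplus> b \<in> S"
    and "\<And>I. delta_small R I \<Longrightarrow> I \<subseteq> S"
  shows "delta R \<subseteq> S"
  unfolding delta_def using assms by (intro sum_right_ideals_subset) (auto simp: delta_small_def)

end

section \<open>Surjective homomorphisms\<close>

locale surj_ring_hom = ring_hom_ring R S h for R (structure) and S (structure) and h +
  assumes surj: "h ` carrier R = carrier S"
begin

lemma right_ideal_image:
  assumes "right_ideal I R" shows "right_ideal (h ` I) S"
proof (rule S.right_idealI)
  note I = right_ideal_simps[OF assms]
  show "h ` I \<subseteq> carrier S" using I(1) by auto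
  show "\<zero>\<^bsub>S\<^esub> \<in> h ` I" using I(2) hom_zero by force
  show "a \<oplus>\<^bsub>S\<^esub> b \<in> h ` I" if ab: "a \<in> h ` I" "b \<in> h ` I" for a b
  proof -
    obtain a' b' where "a' \<in> I" "b' \<in> I" "a = h a'" "b = h b'" using ab by blast
    then have "a \<oplus>\<^bsub>S\<^esub> b = h (a' \<oplus> b')" "a' \<oplus> b' \<in> I"
      using subsetD[OF I(1)] I(3) by auto
    then show ?thesis by blast
  qed
  show "a \<otimes>\<^bsub>S\<^esub> x \<in> h ` I" if ax: "a \<in> h ` I" "x \<in> carrier S" for a x
  proof -
    \<comment> \<open>Surjectivity lifts the arbitrary multiplier x to R.\<close>
    obtain a' x' where "a' \<in> I" "x' \<in> carrier R" "a = h a'" "x = h x'"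
      using ax surj by blast
    then have "a \<otimes>\<^bsub>S\<^esub> x = h (a' \<otimes> x')" "a' \<otimes> x' \<in> I"
      using subsetD[OF I(1)] I(4) by auto
    then show ?thesis by blast
  qed
qed

lemma right_ideal_preimage:
  assumes "right_ideal I S" shows "right_ideal {x \<in> carrier R. h x \<in> I} R"
  using right_ideal_simps[OF assms] by (intro R.right_idealI) auto

text \<open>A right ideal J inside the kernel lies in the preimage, because E contains zero.
  Otherwise h(J) is a nonzero right ideal, so it meets E in some h z \<noteq> 0 with z in J, and
  then z is nonzero too.\<close>

lemma essential_preimage:
  assumes E: "essential_right_ideal S E"
  shows "essential_right_ideal R {x \<in> carrier R. h x \<in> E}"
proof -
  have rE: "right_ideal E S" using E by (simp add: essential_right_ideal_def)
  have "\<exists>x\<in>{x \<in> carrier R. h x \<in> E} \<inter> J. x \<noteq> \<zero>"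
    if J: "right_ideal J R" and x: "x \<in> J" "x \<noteq> \<zero>" for J x
  proof (cases "\<exists>y\<in>J. h y \<noteq> \<zero>\<^bsub>S\<^esub>")
    case True
    then have "\<exists>y\<in>h ` J. y \<noteq> \<zero>\<^bsub>S\<^esub>" by blast
    then obtain z where "z \<in> J" "h z \<in> E" "h z \<noteq> \<zero>\<^bsub>S\<^esub>"
      using E right_ideal_image[OF J] unfolding essential_right_ideal_iff[OF rE] by blast
    moreover have "z \<noteq> \<zero>" using \<open>h z \<noteq> \<zero>\<^bsub>S\<^esub>\<close> by auto
    ultimately show ?thesis using right_ideal_simps(1)[OF J] by blast
  next
    case False
    then have "h x \<in> E" using x right_ideal_simps(2)[OF rE] by auto
    then show ?thesis using x right_ideal_simps(1)[OF J] by blast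
  qed
  then show ?thesis
    unfolding essential_right_ideal_iff[OF right_ideal_preimage[OF rE]] by blast
qed

text \<open>A right ideal K that tests h(I) is pulled back to L, which tests I: R/L is again
  singular and I + L = R. Hence L = R, and surjectivity gives K = S.\<close>

lemma delta_small_image:
  assumes I: "delta_small R I" shows "delta_small S (h ` I)"
  unfolding delta_small_def
proof (intro conjI allI impI; (elim conjE)?)
  have rI: "right_ideal I R" using I by (simp add: delta_small_def)
  show "right_ideal (h ` I) S" by (rule right_ideal_image[OF rI])
  fix K assume K: "right_ideal K S" and sum: "carrier S = h ` I <+>\<^bsub>S\<^esub> K"
    and sing: "singular_right_module S (S Quot K) (quot_ract S K)"
  define L where "L = {x \<in> carrier R. h x \<in> K}"
  have L: "right_ideal L R" unfolding L_def by (rule right_ideal_preimage[OF K])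
  have "essential_right_ideal R {r \<in> carrier R. x \<otimes> r \<in> L}" if x: "x \<in> carrier R" for x
  proof -
    have "essential_right_ideal S {r \<in> carrier S. h x \<otimes>\<^bsub>S\<^esub> r \<in> K}"
      using sing x by (simp add: singular_quotient_iff[OF K])
    from essential_preimage[OF this]
    have "essential_right_ideal R {r \<in> carrier R. h r \<in> carrier S \<and> h x \<otimes>\<^bsub>S\<^esub> h r \<in> K}"
      by simp
    \<comment> \<open>The transporter of x into L is the preimage of the transporter of h x into K,
      so essentiality passes to it.\<close>
    moreover have "{r \<in> carrier R. h r \<in> carrier S \<and> h x \<otimes>\<^bsub>S\<^esub> h r \<in> K} =
        {r \<in> carrier R. x \<otimes> r \<in> L}"
      using x by (auto simp: L_def)
    ultimately show ?thesis by simp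
  qed
  then have "singular_right_module R (R Quot L) (quot_ract R L)"
    by (simp add: singular_quotient_iff[OF L])
  moreover have "carrier R = I <+>\<^bsub>R\<^esub> L"
  proof
    show "I <+>\<^bsub>R\<^esub> L \<subseteq> carrier R"
      using right_ideal_simps(1)[OF rI] right_ideal_simps(1)[OF L] by (auto simp: set_add_def')
    show "carrier R \<subseteq> I <+>\<^bsub>R\<^esub> L"
    proof
      fix x assume x: "x \<in> carrier R"
      have "h x \<in> h ` I <+>\<^bsub>S\<^esub> K"
        unfolding sum[symmetric] by (rule hom_closed[OF x])
      then obtain i k where ik: "i \<in> I" "k \<in> K" "h x = h i \<oplus>\<^bsub>S\<^esub> k"
        by (auto simp: set_add_def')
      have i: "i \<in> carrier R" and k: "k \<in> carrier S"
        using ik right_ideal_simps(1)[OF rI] right_ideal_simps(1)[OF K] by blast+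
      \<comment> \<open>Since h x = h i + k, subtracting the lift i from x leaves an element of
        L.\<close>
      have "h (\<ominus> i \<oplus> x) = k"
        using i x k ik(3) by (simp add: S.r_neg2 S.r_neg1)
      then have "\<ominus> i \<oplus> x \<in> L" using i x ik by (simp add: L_def)
      moreover have "x = i \<oplus> (\<ominus> i \<oplus> x)" using i x by (simp add: R.r_neg2)
      ultimately show "x \<in> I <+>\<^bsub>R\<^esub> L" using ik(1) by (auto simp: set_add_def')
    qed
  qed
  ultimately have "carrier R = L" using I L by (simp add: delta_small_def)
  then have "h ` carrier R \<subseteq> K" by (auto simp: L_def)
  then show "carrier S = K" using surj right_ideal_simps(1)[OF K] by blast
qed

lemma delta_image: "x \<in> delta R \<Longrightarrow> h x \<in> delta S"
proof -
  have "delta R \<subseteq> {x \<in> carrier R. h x \<in> delta S}"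
  proof (rule R.delta_subset)
    fix I assume I: "delta_small R I"
    then show "I \<subseteq> {x \<in> carrier R. h x \<in> delta S}"
      using S.delta_superset[OF delta_small_image[OF I]] right_ideal_simps(1)
      by (auto simp: delta_small_def)
  qed (auto intro: S.delta_zero S.delta_add)
  then show "x \<in> delta R \<Longrightarrow> h x \<in> delta S" by blast
qed

end

section \<open>Direct factors\<close>

text \<open>
  Here \<open>s\<close> is the inclusion of a direct factor \<open>S\<close> of \<open>R\<close> with projection \<open>h\<close>: the last two
  assumptions make its image a two-sided ideal on which \<open>R\<close> acts through \<open>h\<close>. It need not preserve the
  identity.
\<close>

locale direct_factor = ring_hom_ring R S h for R (structure) and S (structure) and h +
  fixes s
  assumes incl_closed: "r \<in> carrier S \<Longrightarrow> s r \<in> carrier R"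
    and proj_incl: "r \<in> carrier S \<Longrightarrow> h (s r) = r"
    and incl_add: "\<lbrakk>r \<in> carrier S; q \<in> carrier S\<rbrakk> \<Longrightarrow> s (r \<oplus>\<^bsub>S\<^esub> q) = s r \<oplus> s q"
    and incl_mult_r: "\<lbrakk>r \<in> carrier S; d \<in> carrier R\<rbrakk> \<Longrightarrow> s r \<otimes> d = s (r \<otimes>\<^bsub>S\<^esub> h d)"
    and incl_mult_l: "\<lbrakk>r \<in> carrier S; d \<in> carrier R\<rbrakk> \<Longrightarrow> d \<otimes> s r = s (h d \<otimes>\<^bsub>S\<^esub> r)"
begin

sublocale surj_ring_hom R S h
proof
  show "h ` carrier R = carrier S" using incl_closed proj_incl by force
qed

lemma incl_mult: "\<lbrakk>r \<in> carrier S; q \<in> carrier S\<rbrakk> \<Longrightarrow> s r \<otimes> s q = s (r \<otimes>\<^bsub>S\<^esub> q)"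
  by (simp add: incl_mult_r incl_closed proj_incl)

lemma incl_zero: "s \<zero>\<^bsub>S\<^esub> = \<zero>"
  using incl_add[of "\<zero>\<^bsub>S\<^esub>" "\<zero>\<^bsub>S\<^esub>"] incl_closed[of "\<zero>\<^bsub>S\<^esub>"]
  by (simp add: R.add.r_cancel_one)

lemma right_ideal_incl:
  assumes "right_ideal I S" shows "right_ideal (s ` I) R"
proof (rule R.right_idealI)
  note I = right_ideal_simps[OF assms]
  show "s ` I \<subseteq> carrier R" using I(1) incl_closed by auto
  show "\<zero> \<in> s ` I" using I(2) incl_zero by force
  show "a \<oplus> b \<in> s ` I" if ab: "a \<in> s ` I" "b \<in> s ` I" for a b
  proof -
    obtain a' b' where "a' \<in> I" "b' \<in> I" "a = s a'" "b = s b'" using ab by blast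
    then have "a \<oplus> b = s (a' \<oplus>\<^bsub>S\<^esub> b')" "a' \<oplus>\<^bsub>S\<^esub> b' \<in> I"
      using subsetD[OF I(1)] I(3) incl_add by auto
    then show ?thesis by blast
  qed
  show "a \<otimes> x \<in> s ` I" if ax: "a \<in> s ` I" "x \<in> carrier R" for a x
  proof -
    obtain a' where "a' \<in> I" "a = s a'" using ax by blast
    then have "a \<otimes> x = s (a' \<otimes>\<^bsub>S\<^esub> h x)" "a' \<otimes>\<^bsub>S\<^esub> h x \<in> I"
      using subsetD[OF I(1)] I(4) ax(2) incl_mult_r by auto
    then show ?thesis by blast
  qed
qed

text \<open>A right ideal K that tests s(I) is projected to h(K), which tests I, so h(K) = S. This
  alone only describes K modulo the kernel of h. That K contains s(S) follows because multiplication
  by elements of s(S) sees only the projection to S.\<close>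

lemma delta_small_incl:
  assumes I: "delta_small S I" shows "delta_small R (s ` I)"
  unfolding delta_small_def
proof (intro conjI allI impI; (elim conjE)?)
  have rI: "right_ideal I S" using I by (simp add: delta_small_def)
  show "right_ideal (s ` I) R" by (rule right_ideal_incl[OF rI])
  fix K assume K: "right_ideal K R" and sum: "carrier R = s ` I <+>\<^bsub>R\<^esub> K"
    and sing: "singular_right_module R (R Quot K) (quot_ract R K)"
  note K' = right_ideal_simps[OF K]
  have hK: "right_ideal (h ` K) S" by (rule right_ideal_image[OF K])
  have "essential_right_ideal S {r \<in> carrier S. x \<otimes>\<^bsub>S\<^esub> r \<in> h ` K}" if x: "x \<in> carrier S" for x
  proof -
    have ess: "essential_right_ideal R {r \<in> carrier R. s x \<otimes> r \<in> K}"
      using sing x incl_closed by (simp add: singular_quotient_iff[OF K])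
    have "\<exists>y\<in>{r \<in> carrier S. x \<otimes>\<^bsub>S\<^esub> r \<in> h ` K} \<inter> J. y \<noteq> \<zero>\<^bsub>S\<^esub>"
      if J: "right_ideal J S" and j: "j \<in> J" "j \<noteq> \<zero>\<^bsub>S\<^esub>" for J j
    proof -
      have jS: "j \<in> carrier S" using j right_ideal_simps(1)[OF J] by blast
      have "s j \<noteq> \<zero>" using proj_incl[OF jS] j hom_zero by metis
      \<comment> \<open>The nonzero right ideal s(J) meets the essential transporter of s x into K.
        Projecting s x s i from K to S shows that x i lies in h(K).\<close>
      then have "\<exists>y\<in>{r \<in> carrier R. s x \<otimes> r \<in> K} \<inter> s ` J. y \<noteq> \<zero>"
        using ess right_ideal_incl[OF J] j(1)
        unfolding essential_right_ideal_iff[OF right_ideal_transporter[OF K incl_closed[OF x]]]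
        by blast
      then obtain i where i: "i \<in> J" "s x \<otimes> s i \<in> K" "s i \<noteq> \<zero>" by blast
      have iS: "i \<in> carrier S" using i right_ideal_simps(1)[OF J] by blast
      have "x \<otimes>\<^bsub>S\<^esub> i = h (s x \<otimes> s i)" using x iS by (simp add: incl_closed proj_incl)
      then have "x \<otimes>\<^bsub>S\<^esub> i \<in> h ` K" using i(2) by blast
      moreover have "i \<noteq> \<zero>\<^bsub>S\<^esub>" using i(3) incl_zero by blast
      ultimately show ?thesis using i(1) iS by blast
    qed
    then show ?thesis
      unfolding essential_right_ideal_iff[OF right_ideal_transporter[OF hK x]] by blast
  qed
  then have "singular_right_module S (S Quot (h ` K)) (quot_ract S (h ` K))"
    by (simp add: singular_quotient_iff[OF hK])
  moreover have "carrier S = I <+>\<^bsub>S\<^esub> h ` K"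
  proof
    show "I <+>\<^bsub>S\<^esub> h ` K \<subseteq> carrier S"
      using S.set_add_closed[OF right_ideal_simps(1)[OF rI] right_ideal_simps(1)[OF hK]] .
    show "carrier S \<subseteq> I <+>\<^bsub>S\<^esub> h ` K"
    proof
      fix x assume x: "x \<in> carrier S"
      then have "s x \<in> s ` I <+>\<^bsub>R\<^esub> K" using sum incl_closed by auto
      then obtain i k where ik: "i \<in> I" "k \<in> K" "s x = s i \<oplus> k"
        by (auto simp: set_add_def')
      have i: "i \<in> carrier S" and k: "k \<in> carrier R"
        using ik right_ideal_simps(1)[OF rI] K'(1) by blast+
      have "x = i \<oplus>\<^bsub>S\<^esub> h k"
        using arg_cong[OF ik(3), of h] x i k by (simp add: incl_closed proj_incl)
      then show "x \<in> I <+>\<^bsub>S\<^esub> h ` K" using ik by (auto simp: set_add_def')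
    qed
  qed
  ultimately have "carrier S = h ` K" using I hK by (simp add: delta_small_def)
  \<comment> \<open>This k acts as a left identity on the factor: k s(x) = s(h(k) x) = s(x). As K is
    a right ideal, it absorbs all of s(S).\<close>
  then obtain k where k: "k \<in> K" "h k = \<one>\<^bsub>S\<^esub>" by (metis S.one_closed imageE)
  have "s x \<in> K" if x: "x \<in> carrier S" for x
  proof -
    have "s x = k \<otimes> s x" using k x K'(1) by (auto simp: incl_mult_l)
    then show ?thesis using K'(4)[OF k(1) incl_closed[OF x]] by simp
  qed
  then have "s ` I \<subseteq> K" using right_ideal_simps(1)[OF rI] by blast
  then have "s ` I <+>\<^bsub>R\<^esub> K \<subseteq> K" using K'(3) by (auto simp: set_add_def')
  then show "carrier R = K" using sum K'(1) by blast
qed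

lemma delta_incl: "x \<in> delta S \<Longrightarrow> s x \<in> delta R"
proof -
  have "delta S \<subseteq> {x \<in> carrier S. s x \<in> delta R}"
  proof (rule S.delta_subset)
    fix I assume I: "delta_small S I"
    then show "I \<subseteq> {x \<in> carrier S. s x \<in> delta R}"
      using R.delta_superset[OF delta_small_incl[OF I]] right_ideal_simps(1)
      by (auto simp: delta_small_def)
  qed (auto simp: incl_zero incl_add intro: R.delta_zero R.delta_add)
  then show "x \<in> delta S \<Longrightarrow> s x \<in> delta R" by blast
qed

text \<open>If y commutes with a, then h y commutes with h a and hence with p. The products of s p
  and y are s(p h(y)) and s(h(y) p), which therefore agree.\<close>

lemma comm2_incl:
  assumes a: "a \<in> carrier R" and p: "p \<in> comm2 S (h a)"
  shows "s p \<in> comm2 R a"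
  unfolding comm2_def
proof (intro CollectI conjI ballI)
  have pS: "p \<in> carrier S" using p by (simp add: comm2_def)
  then show "s p \<in> carrier R" by (rule incl_closed)
  fix y assume y: "y \<in> comm R a"
  then have yR: "y \<in> carrier R" by (simp add: comm_def)
  have "h y \<otimes>\<^bsub>S\<^esub> h a = h a \<otimes>\<^bsub>S\<^esub> h y"
    using y a by (simp add: comm_def flip: hom_mult)
  then have "h y \<in> comm S (h a)" using yR by (simp add: comm_def)
  then have "p \<otimes>\<^bsub>S\<^esub> h y = h y \<otimes>\<^bsub>S\<^esub> p" using p by (simp add: comm2_def)
  then show "s p \<otimes> y = y \<otimes> s p" using pS yR by (simp add: incl_mult_l incl_mult_r)
qed

text \<open>If y commutes with a, then s y commutes with s a and hence with p. Applying h brings the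
  relation back to S.\<close>

lemma comm2_proj:
  assumes a: "a \<in> carrier S" and p: "p \<in> comm2 R (s a)"
  shows "h p \<in> comm2 S a"
  unfolding comm2_def
proof (intro CollectI conjI ballI)
  have pR: "p \<in> carrier R" using p by (simp add: comm2_def)
  then show "h p \<in> carrier S" by simp
  fix y assume y: "y \<in> comm S a"
  then have yS: "y \<in> carrier S" by (simp add: comm_def)
  have "s y \<in> comm R (s a)" using y a yS by (simp add: comm_def incl_closed incl_mult)
  then have "h (p \<otimes> s y) = h (s y \<otimes> p)" using p by (simp add: comm2_def)
  then show "h p \<otimes>\<^bsub>S\<^esub> y = y \<otimes>\<^bsub>S\<^esub> h p" using pR yS by (simp add: incl_closed proj_incl)
qed

text \<open>A witness for a is found by including a into R, taking a witness for s a there, and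
  projecting it to S.\<close>

lemma delta_quasipolar_factor:
  assumes "delta_quasipolar R" shows "delta_quasipolar S"
  unfolding delta_quasipolar_def
proof (intro conjI ballI S.ring_axioms)
  fix a assume a: "a \<in> carrier S"
  then obtain p where p: "p \<in> comm2 R (s a)" "p \<otimes> p = p" "s a \<oplus> p \<in> delta R"
    using assms incl_closed by (auto simp: delta_quasipolar_def delta_quasipolar_elem_def)
  have pR: "p \<in> carrier R" using p by (simp add: comm2_def)
  have "h p \<otimes>\<^bsub>S\<^esub> h p = h p" using p(2) pR by (simp flip: hom_mult)
  moreover have "a \<oplus>\<^bsub>S\<^esub> h p \<in> delta S"
    using delta_image[OF p(3)] a pR by (simp add: incl_closed proj_incl)
  ultimately show "delta_quasipolar_elem S a"
    using comm2_proj[OF a p(1)] by (auto simp: delta_quasipolar_elem_def)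
qed

end

section \<open>Dorroh extensions as direct products\<close>

context dorroh_pair
begin

abbreviation "D \<equiv> dorroh R V lact ract"
abbreviation unit_hom :: "'a \<Rightarrow> 'b" where "unit_hom r \<equiv> lact r \<one>\<^bsub>V\<^esub>"

lemma unit_hom_closed: "r \<in> carrier R \<Longrightarrow> unit_hom r \<in> carrier V"
  by (simp add: lact_closed)

lemma lact_conv: "\<lbrakk>r \<in> carrier R; v \<in> carrier V\<rbrakk> \<Longrightarrow> lact r v = unit_hom r \<otimes>\<^bsub>V\<^esub> v"
  by (simp add: lact_mult)

text \<open>The balancing law \<open>ract_mult\<close> gives v r = (v r) 1 = v (r 1). So the right
  action is governed by the same map \<open>unit_hom\<close> as the left one.\<close>

lemma ract_conv: "\<lbrakk>r \<in> carrier R; v \<in> carrier V\<rbrakk> \<Longrightarrow> ract v r = v \<otimes>\<^bsub>V\<^esub> unit_hom r"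
  using ract_mult[of v "\<one>\<^bsub>V\<^esub>" r] by (simp add: ract_closed)

lemma unit_hom_mult:
  "\<lbrakk>r \<in> carrier R; q \<in> carrier R\<rbrakk> \<Longrightarrow> unit_hom (r \<otimes>\<^bsub>R\<^esub> q) = unit_hom r \<otimes>\<^bsub>V\<^esub> unit_hom q"
  by (simp add: lact_assoc lact_conv[of r "lact q \<one>\<^bsub>V\<^esub>"] lact_closed)

lemma dorroh_simps:
  "carrier D = carrier R \<times> carrier V"
  "(r, v) \<oplus>\<^bsub>D\<^esub> (q, w) = (r \<oplus>\<^bsub>R\<^esub> q, v \<oplus>\<^bsub>V\<^esub> w)"
  "\<one>\<^bsub>D\<^esub> = (\<one>\<^bsub>R\<^esub>, \<zero>\<^bsub>V\<^esub>)"
  by (simp_all add: dorroh_def)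

lemma dorroh_mult:
  assumes "r \<in> carrier R" "q \<in> carrier R" "v \<in> carrier V" "w \<in> carrier V"
  shows "(r, v) \<otimes>\<^bsub>D\<^esub> (q, w) = (r \<otimes>\<^bsub>R\<^esub> q,
    unit_hom r \<otimes>\<^bsub>V\<^esub> w \<oplus>\<^bsub>V\<^esub> v \<otimes>\<^bsub>V\<^esub> unit_hom q \<oplus>\<^bsub>V\<^esub> v \<otimes>\<^bsub>V\<^esub> w)"
  using assms by (simp add: dorroh_def lact_conv[of r w] ract_conv)

text \<open>The second coordinate of the identification with the direct product of R and V.\<close>

definition proj2 :: "'a \<times> 'b \<Rightarrow> 'b" where
  "proj2 x = unit_hom (fst x) \<oplus>\<^bsub>V\<^esub> snd x"

text \<open>This element has product coordinates (r, 0). The pairs (r, 0) of the Dorroh extension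
  also form a copy of R, but in general not an ideal.\<close>

definition incl1 :: "'a \<Rightarrow> 'a \<times> 'b" where
  "incl1 r = (r, \<ominus>\<^bsub>V\<^esub> unit_hom r)"

definition incl2 :: "'b \<Rightarrow> 'a \<times> 'b" where
  "incl2 v = (\<zero>\<^bsub>R\<^esub>, v)"

lemma unit_hom_zero: "unit_hom \<zero>\<^bsub>R\<^esub> = \<zero>\<^bsub>V\<^esub>"
  using lact_l_distr[of "\<zero>\<^bsub>R\<^esub>" "\<zero>\<^bsub>R\<^esub>" "\<one>\<^bsub>V\<^esub>"] lact_closed[of "\<zero>\<^bsub>R\<^esub>" "\<one>\<^bsub>V\<^esub>"]
  by (simp add: M.add.r_cancel_one)

text \<open>Write f for \<open>unit_hom\<close>. In (r, - f r)(q, w) the terms f r w and - f r w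
  cancel, leaving - f r f q = - f (r q). The product in the other order is similar.\<close>

sublocale D1: direct_factor D R fst incl1
proof (intro direct_factor.intro direct_factor_axioms.intro ring_hom_ringI2)
  show "ring D" by (rule dorroh_ring)
  show "ring R" by (rule R.ring_axioms)
  show "fst \<in> ring_hom D R"
    by (rule ring_hom_memI) (auto simp: dorroh_simps dorroh_mult)
next
  fix r d assume r: "r \<in> carrier R" and d: "d \<in> carrier D"
  obtain q w where qw: "d = (q, w)" "q \<in> carrier R" "w \<in> carrier V"
    using d by (auto simp: dorroh_simps)
  note * = unit_hom_closed[OF r] unit_hom_closed[OF qw(2)]
  show "incl1 r \<otimes>\<^bsub>D\<^esub> d = incl1 (r \<otimes>\<^bsub>R\<^esub> fst d)"
    using r qw * by (simp add: incl1_def dorroh_mult unit_hom_mult V.l_minus M.a_ac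
        M.r_neg M.r_neg1 M.r_neg2)
  show "d \<otimes>\<^bsub>D\<^esub> incl1 r = incl1 (fst d \<otimes>\<^bsub>R\<^esub> r)"
    using r qw * by (simp add: incl1_def dorroh_mult unit_hom_mult V.r_minus M.a_assoc
        M.r_neg M.r_neg1 M.r_neg2)
qed (auto simp: incl1_def dorroh_simps unit_hom_closed lact_l_distr M.minus_add)

text \<open>With f for \<open>unit_hom\<close>, multiplicativity of \<open>proj2\<close> is the
  expansion of (f r + v)(f q + w), whose last three terms form the second component of the Dorroh
  product.\<close>

sublocale D2: direct_factor D V proj2 incl2
proof (intro direct_factor.intro direct_factor_axioms.intro ring_hom_ringI2)
  show "ring D" by (rule dorroh_ring)
  show "ring V" by (rule V.ring_axioms)
  show "proj2 \<in> ring_hom D V"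
    by (rule ring_hom_memI)
      (auto simp: proj2_def dorroh_simps dorroh_mult unit_hom_closed unit_hom_mult lact_l_distr
        lact_one V.l_distr V.r_distr M.a_ac)
next
  fix v d assume v: "v \<in> carrier V" and d: "d \<in> carrier D"
  obtain q w where qw: "d = (q, w)" "q \<in> carrier R" "w \<in> carrier V"
    using d by (auto simp: dorroh_simps)
  show "incl2 v \<otimes>\<^bsub>D\<^esub> d = incl2 (v \<otimes>\<^bsub>V\<^esub> proj2 d)"
    using v qw unit_hom_closed[OF qw(2)]
    by (simp add: incl2_def proj2_def dorroh_mult unit_hom_zero V.r_distr)
  show "d \<otimes>\<^bsub>D\<^esub> incl2 v = incl2 (proj2 d \<otimes>\<^bsub>V\<^esub> v)"
    using v qw unit_hom_closed[OF qw(2)]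
    by (simp add: incl2_def proj2_def dorroh_mult unit_hom_zero V.l_distr)
qed (auto simp: incl2_def proj2_def dorroh_simps unit_hom_zero)

lemma incl_decomp: "x \<in> carrier D \<Longrightarrow> x = incl1 (fst x) \<oplus>\<^bsub>D\<^esub> incl2 (proj2 x)"
  by (auto simp: incl1_def incl2_def proj2_def dorroh_simps unit_hom_closed M.r_neg1)

lemma delta_quasipolar_dorroh:
  assumes R: "delta_quasipolar R" and V: "carrier V = delta V"
  shows "delta_quasipolar D"
  unfolding delta_quasipolar_def
proof (intro conjI ballI dorroh_ring)
  fix a assume a: "a \<in> carrier D"
  then have "fst a \<in> carrier R" by simp
  then obtain p where p: "p \<in> comm2 R (fst a)" "p \<otimes>\<^bsub>R\<^esub> p = p" "fst a \<oplus>\<^bsub>R\<^esub> p \<in> delta R"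
    using R by (auto simp: delta_quasipolar_def delta_quasipolar_elem_def)
  have pR: "p \<in> carrier R" using p by (simp add: comm2_def)
  \<comment> \<open>Both product coordinates of x lie in the respective \<delta>: the first is
    \<open>fst a\<close> plus p, and the second lies in V = \<delta>(V). \<open>incl_decomp\<close>
    reassembles x from them.\<close>
  define x where "x = a \<oplus>\<^bsub>D\<^esub> incl1 p"
  have x: "x \<in> carrier D" using a pR by (simp add: x_def D1.incl_closed)
  have "fst x \<in> delta R" using p(3) a pR by (simp add: x_def D1.incl_closed D1.proj_incl)
  moreover have "proj2 x \<in> delta V" using x V by (metis D2.hom_closed)
  ultimately have "incl1 (fst x) \<oplus>\<^bsub>D\<^esub> incl2 (proj2 x) \<in> delta D"
    by (intro D1.R.delta_add D1.delta_incl D2.delta_incl)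
  then have "a \<oplus>\<^bsub>D\<^esub> incl1 p \<in> delta D" using incl_decomp[OF x] by (simp add: x_def)
  moreover have "incl1 p \<otimes>\<^bsub>D\<^esub> incl1 p = incl1 p" using p(2) pR by (simp add: D1.incl_mult)
  ultimately show "delta_quasipolar_elem D a"
    using D1.comm2_incl[OF a p(1)] by (auto simp: delta_quasipolar_elem_def)
qed

end

theorem proposition2p24:
  fixes R :: "('a, 'm) ring_scheme" and V :: "('b, 'n) ring_scheme"
    and lact :: "'a \<Rightarrow> 'b \<Rightarrow> 'b" and ract :: "'b \<Rightarrow> 'a \<Rightarrow> 'b"
  assumes "dorroh_pair R V lact ract"
  shows "(delta_quasipolar (dorroh R V lact ract) \<longrightarrow> delta_quasipolar R)
    \<and> (delta_quasipolar R
         \<and> (\<forall>e\<in>carrier R. e \<otimes>\<^bsub>R\<^esub> e = e \<longrightarrow> (\<forall>v\<in>carrier V. lact e v = ract v e))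
         \<and> carrier V = delta V
       \<longrightarrow> delta_quasipolar (dorroh R V lact ract))"
proof -
  interpret dorroh_pair R V lact ract by fact
  \<comment> \<open>The first part is descent to the direct factor R along
    \<open>fst\<close>.\<close>
  show ?thesis using D1.delta_quasipolar_factor delta_quasipolar_dorroh by blast
qed

end
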